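(* Let $p\ge1$ be an integer and $x$ a parameter. Let $\mathfrak{E}_{n,k}^{(p)}$ be the generalized Motzkin numbers associated with the sequences $\sigma_k=x-\frac{p}{2}$ and $\tau_k=-\frac{k(k+p-1)}{4}$ ($k\ge0$). Then for every $n\ge0$, $\mathfrak{E}_{n,0}^{(p)}=E_n^{(p)}(x)$.
   Context: The higher-order Euler polynomials $E_n^{(p)}(x)$ are defined by \[ \left(\frac{2}{e^{z}+1}\right)^{p}e^{xz}=\sum_{n=0}^{\infty}E_{n}^{(p)}(x)\frac{z^{n}}{n!}. \] Given arbitrary sequences $(\sigma_k)$ and $(\tau_k)$, the generalized Motzkin numbers $M_{n,k}$ ($n,k$ integers) are defined by $M_{0,0}=1$, $M_{n,k}=0$ whenever $k>n$ or $k<0$, and the recurrence \[ M_{n+1,k}=M_{n,k-1}+\sigma_kM_{n,k}+\tau_{k+1}M_{n,k+1}. \] Here $\mathfrak{E}_{n,k}^{(p)}$ denotes $M_{n,k}$ for the stated choices of $\sigma_k,\tau_k$. *)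

theory Defs
  imports "HOL-Computational_Algebra.Formal_Power_Series"
begin

definition higher_euler :: "nat \<Rightarrow> nat \<Rightarrow> 'a :: field_char_0 \<Rightarrow> 'a" where
  "higher_euler p n x = fact n * fps_nth ((2 / (fps_exp 1 + 1)) ^ p * fps_exp x) n"

lemma higher_euler_generating_function:
  "Abs_fps (\<lambda>n. higher_euler p n x / fact n) = (2 / (fps_exp 1 + 1)) ^ p * fps_exp x"
  by (simp add: fps_eq_iff higher_euler_def)

(* The sequences are indexed by k >= 0 and the recurrence is imposed for n, k >= 0 only:
   at n = -1 it would contradict M(0,0) = 1, and at k = -1 it would constrain tau 0. *)
function motzkin ::
    "(nat \<Rightarrow> 'a :: comm_ring_1) \<Rightarrow> (nat \<Rightarrow> 'a) \<Rightarrow> int \<Rightarrow> int \<Rightarrow> 'a" where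
  "motzkin \<sigma> \<tau> n k =
     (if k > n \<or> k < 0 then 0
      else if n = 0 then 1
      else motzkin \<sigma> \<tau> (n - 1) (k - 1)
           + \<sigma> (nat k) * motzkin \<sigma> \<tau> (n - 1) k
           + \<tau> (nat k + 1) * motzkin \<sigma> \<tau> (n - 1) (k + 1))"
  by pat_completeness auto
termination by (relation "measure (\<lambda>(_, _, n, _). nat n)") auto

declare motzkin.simps [simp del]

lemma motzkin_0_0: "motzkin \<sigma> \<tau> 0 0 = 1"
  by (simp add: motzkin.simps)

lemma motzkin_outside: "k > n \<or> k < 0 \<Longrightarrow> motzkin \<sigma> \<tau> n k = 0"
  by (simp add: motzkin.simps)

lemma motzkin_rec:
  assumes "n \<ge> 0" "k \<ge> 0"
  shows "motzkin \<sigma> \<tau> (n + 1) k =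
           motzkin \<sigma> \<tau> n (k - 1) + \<sigma> (nat k) * motzkin \<sigma> \<tau> n k
           + \<tau> (nat k + 1) * motzkin \<sigma> \<tau> n (k + 1)"
proof (cases "k > n + 1")
  case True
  then show ?thesis by (simp add: motzkin_outside)
next
  case False
  then show ?thesis using assms by (subst motzkin.simps) simp
qed

end

theory Submission
  imports Defs
begin

(* The columns of the Motzkin triangle have exponential generating functions F 0, F 1, ...
   characterised by F k' = F (k - 1) + sigma k * F k + tau (k + 1) * F (k + 1) and
   F k (0) = [k = 0].  With U = 2 / (exp z + 1), the functions
   F k = U^p exp (x z) (2 (1 - U))^k / k! solve this system for the given sigma and tau, because
   U' = U (U - 2) / 2; here 1 - U = tanh (z / 2).  The column k = 0 is the generating function
   of the Euler polynomials. *)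

unbundle fps_syntax

text \<open>Since \<open>fps_deriv f $ n = of_nat (n + 1) * f $ (n + 1)\<close>, taking coefficient
  \<open>n\<close> of the differential system and multiplying by \<open>fact n\<close> yields
  exactly the Motzkin recurrence. The induction keeps \<open>k\<close> arbitrary because a row draws
  on neighbouring columns of the row before.\<close>

lemma motzkin_eq_fps_nth:
  fixes F :: "nat \<Rightarrow> 'a :: {comm_ring_1, semiring_char_0} fps"
  assumes init: "\<And>k. F k $ 0 = (if k = 0 then 1 else 0)"
    and deriv_0: "fps_deriv (F 0) = fps_const (\<sigma> 0) * F 0 + fps_const (\<tau> 1) * F 1"
    and deriv_Suc: "\<And>k. fps_deriv (F (Suc k)) =
      F k + fps_const (\<sigma> (Suc k)) * F (Suc k) + fps_const (\<tau> (k + 2)) * F (k + 2)"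
  shows "motzkin \<sigma> \<tau> (int n) (int k) = fact n * F k $ n"
proof (induction n arbitrary: k)
  case 0
  show ?case
    by (cases "k = 0") (simp_all add: init motzkin_0_0 motzkin_outside)
next
  case (Suc n)
  have step: "fact (Suc n) * F k $ Suc n = fact n * fps_deriv (F k) $ n"
    by (simp add: algebra_simps)
  show ?case
  proof (cases k)
    case 0
    \<comment> \<open>Column -1 vanishes, which is why \<open>deriv_0\<close> has only two
      terms.\<close>
    have "motzkin \<sigma> \<tau> (int n + 1) 0 =
        \<sigma> 0 * motzkin \<sigma> \<tau> (int n) 0 + \<tau> 1 * motzkin \<sigma> \<tau> (int n) 1"
      by (subst motzkin_rec) (simp_all add: motzkin_outside)
    then show ?thesis
      unfolding step using 0 Suc.IH[of 0] Suc.IH[of 1]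
      by (simp add: deriv_0 algebra_simps)
  next
    case (Suc j)
    have "motzkin \<sigma> \<tau> (int n + 1) (int j + 1) =
        motzkin \<sigma> \<tau> (int n) (int j) + \<sigma> (Suc j) * motzkin \<sigma> \<tau> (int n) (int (Suc j))
        + \<tau> (j + 2) * motzkin \<sigma> \<tau> (int n) (int (j + 2))"
      by (subst motzkin_rec) (simp_all add: nat_add_distrib algebra_simps)
    then show ?thesis
      unfolding step using Suc Suc.IH[of j] Suc.IH[of "Suc j"] Suc.IH[of "j + 2"]
      by (simp add: deriv_Suc algebra_simps)
  qed
qed

lemma fps_euler_kernel_nth_0:
  "(2 / (fps_exp 1 + 1) :: 'a :: field_char_0 fps) $ 0 = 1"
  by (simp add: fps_divide_unit fps_numeral_nth)

text \<open>Differentiate \<open>U * ?D = 2\<close>, replace \<open>fps_exp 1\<close> by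
  \<open>?D - 1\<close>, and write the constant 2 again as \<open>U * ?D\<close>; then the nonzero
  factor \<open>?D\<close> cancels.\<close>

lemma fps_deriv_euler_kernel:
  fixes U :: "'a :: field_char_0 fps"
  defines "U \<equiv> 2 / (fps_exp 1 + 1)"
  shows "2 * fps_deriv U = U * (U - 2)"
proof -
  let ?D = "fps_exp 1 + 1 :: 'a fps"
  have D0: "?D \<noteq> 0"
    by (rule fps_nonzeroI[of _ 0]) simp
  have UD: "U * ?D = 2"
    unfolding U_def by (simp add: fps_divide_unit mult.assoc inverse_mult_eq_1)
  have "fps_deriv (U * ?D) = 0"
    unfolding UD by (metis fps_deriv_numeral)
  then have "fps_deriv U * ?D + U * fps_exp 1 = 0"
    by (simp add: algebra_simps)
  then have "2 * fps_deriv U * ?D = U * (U - 2) * ?D"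
    using UD by algebra
  with D0 show ?thesis by simp
qed

theorem theorem1p3:
  fixes p n :: nat and x :: "'a :: field_char_0"
  assumes "p \<ge> 1"
  shows "motzkin (\<lambda>k. x - of_nat p / 2)
                 (\<lambda>k. - (of_nat k * (of_nat k + of_nat p - 1) / 4))
                 (int n) 0
         = higher_euler p n x"
proof -
  define U :: "'a fps" where "U = 2 / (fps_exp 1 + 1)"
  define G where "G = U ^ p * fps_exp x"
  define T where "T = 1 - U"
  define \<sigma> :: "nat \<Rightarrow> 'a" where "\<sigma> = (\<lambda>k. x - of_nat p / 2)"
  define \<tau> :: "nat \<Rightarrow> 'a" where "\<tau> = (\<lambda>k. - (of_nat k * (of_nat k + of_nat p - 1) / 4))"
  define c :: "nat \<Rightarrow> 'a fps" where "c k = fps_const (2 ^ k / fact k)" for k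
  define F where "F k = c k * (G * T ^ k)" for k
  \<comment> \<open>One half as a constant series: with \<open>h * 2 = 1\<close>, the later
    identities need only ring arithmetic instead of series division.\<close>
  define h :: "'a fps" where "h = fps_const (1 / 2)"
  define S :: "'a fps" where "S = fps_const x - h * of_nat p"
  have h: "h * 2 = 1"
    unfolding h_def by (simp add: fps_eq_iff fps_numeral_nth)
  have U0: "U $ 0 = 1"
    unfolding U_def by (rule fps_euler_kernel_nth_0)
  have dU: "fps_deriv U = h * (U * (U - 2))"
    using fps_deriv_euler_kernel[where 'a = 'a, folded U_def] h
    by (metis mult.assoc mult.left_neutral)
  have dT: "fps_deriv T = h * (1 - T\<^sup>2)"
    unfolding T_def by (simp add: dU algebra_simps power2_eq_square)
  have dUp: "fps_deriv (U ^ p) = of_nat p * h * (U - 2) * U ^ p"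
  proof -
    have "fps_deriv (U ^ p) = h * (U - 2) * (of_nat p * (U * U ^ (p - 1)))"
      by (simp add: fps_deriv_power' dU mult_ac)
    \<comment> \<open>The factor \<open>of_nat p\<close> absorbs the truncated \<open>p - 1\<close>
      at \<open>p = 0\<close>.\<close>
    also have "of_nat p * (U * U ^ (p - 1)) = of_nat p * U ^ p"
      by (cases p) simp_all
    finally show ?thesis by (simp add: mult_ac)
  qed
  \<comment> \<open>As \<open>U - 2 = - (1 + T)\<close>, the logarithmic derivative of
    \<open>G\<close> is x - (p/2)(1 + T), whose constant part \<open>S\<close> is the weight
    \<open>\<sigma>\<close>.\<close>
  have dG: "fps_deriv G = (S - h * of_nat p * T) * G"
    unfolding G_def S_def T_def by (simp add: dUp algebra_simps)
  have c_0: "c 0 = 1"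
    by (simp add: c_def)
  have c_Suc: "c (Suc k) * (of_nat k + 1) = 2 * c k" for k
  proof -
    have "2 ^ Suc k / fact (Suc k) * of_nat (Suc k) = 2 * (2 ^ k / fact k :: 'a)"
      by (simp add: fact_Suc del: of_nat_Suc)
    then have "c (Suc k) * of_nat (Suc k) = 2 * c k"
      unfolding c_def fps_of_nat[symmetric] fps_numeral_fps_const fps_const_mult by simp
    then show ?thesis by (simp add: add.commute)
  qed
  have \<sigma>: "fps_const (\<sigma> k) = S" for k
    by (simp add: \<sigma>_def S_def h_def fps_of_nat[symmetric])
  have \<tau>: "fps_const (\<tau> (Suc k)) = - (h * h * (of_nat k + 1) * (of_nat k + of_nat p))" for k
    by (simp add: \<tau>_def h_def add.commute fps_of_nat[symmetric] flip: fps_const_1_eq_1)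
  have "motzkin \<sigma> \<tau> (int n) (int 0) = fact n * F 0 $ n"
  proof (rule motzkin_eq_fps_nth)
    show "F k $ 0 = (if k = 0 then 1 else 0)" for k
      by (simp add: F_def c_def G_def T_def U0 fps_nth_power_0)
    show "fps_deriv (F 0) = fps_const (\<sigma> 0) * F 0 + fps_const (\<tau> 1) * F 1"
    proof -
      have "fps_deriv (F 0) = S * G - (h * of_nat p) * (G * T)"
        by (simp add: F_def c_0 dG algebra_simps)
      \<comment> \<open>The inserted \<open>h * 2\<close> supplies the factor 2 of
        \<open>c 1\<close> and the second \<open>h\<close> of \<open>\<tau> 1\<close>.\<close>
      also have "\<dots> = S * G - (h * 2) * (h * of_nat p) * (G * T)"
        by (simp add: h)
      finally show ?thesis
        using c_Suc[of 0] by (simp add: F_def c_0 \<sigma> \<tau>[of 0, simplified] algebra_simps)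
    qed
    show "fps_deriv (F (Suc k)) =
        F k + fps_const (\<sigma> (Suc k)) * F (Suc k) + fps_const (\<tau> (k + 2)) * F (k + 2)" for k
    proof -
      have dc: "fps_deriv (c k) = 0" for k
        by (simp add: c_def)
      have dT_Suc: "fps_deriv (T ^ Suc k) = (of_nat k + 1) * (h * (1 - T\<^sup>2)) * T ^ k"
        by (simp only: fps_deriv_power' diff_Suc_1 dT of_nat_Suc add.commute)
      \<comment> \<open>The powers \<open>k\<close>, \<open>k + 1\<close>, \<open>k + 2\<close> of
        \<open>T\<close> will match \<open>F k\<close>, \<open>F (Suc k)\<close>,
        \<open>F (k + 2)\<close>. The top one collects -(k + 1)/2 from \<open>T ^ Suc k\<close> and
        -p/2 from \<open>G\<close>, which explains the factor k + 1 + p in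
        \<open>\<tau> (k + 2)\<close>.\<close>
      have dF: "fps_deriv (F (Suc k)) = c (Suc k) * ((S - h * of_nat p * T) * G * (T * T ^ k)
          + G * ((of_nat k + 1) * T ^ k * (h * (1 - T\<^sup>2))))"
        unfolding F_def fps_deriv_mult dc dG dT_Suc by (simp add: algebra_simps)
      have c2: "c (Suc (Suc k)) * (of_nat k + 2) = 2 * c (Suc k)"
        using c_Suc[of "Suc k"] by (simp add: algebra_simps)
      have \<tau>2: "fps_const (\<tau> (k + 2)) = - (h * h * (of_nat k + 2) * (of_nat k + 1 + of_nat p))"
        using \<tau>[of "Suc k"] by (simp add: algebra_simps)
      have ck: "c k = h * (c (Suc k) * (of_nat k + 1))"
        unfolding c_Suc by (metis h mult.assoc mult.left_neutral)
      have "F k + fps_const (\<sigma> (Suc k)) * F (Suc k) + fps_const (\<tau> (k + 2)) * F (k + 2) =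
          c k * (G * T ^ k) + S * c (Suc k) * (G * (T * T ^ k))
          - h * h * (c (Suc (Suc k)) * (of_nat k + 2)) * (of_nat k + 1 + of_nat p) * (G * (T\<^sup>2 * T ^ k))"
        unfolding \<sigma> \<tau>2 F_def by (simp add: power2_eq_square mult_ac)
      also have "\<dots> = h * (c (Suc k) * (of_nat k + 1)) * (G * T ^ k)
          + S * c (Suc k) * (G * (T * T ^ k))
          - (h * 2) * (h * c (Suc k)) * (of_nat k + 1 + of_nat p) * (G * (T\<^sup>2 * T ^ k))"
        unfolding c2 ck[symmetric] by (simp only: mult_ac)
      also have "\<dots> = fps_deriv (F (Suc k))"
        unfolding dF h by (simp add: power2_eq_square algebra_simps)
      finally show ?thesis ..
    qed
  qed
  moreover have "F 0 = (2 / (fps_exp 1 + 1)) ^ p * fps_exp x"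
    by (simp add: F_def c_0 G_def U_def)
  ultimately show ?thesis
    by (simp add: higher_euler_def \<sigma>_def \<tau>_def)
qed

end
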